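(* Let $\mathcal F$ be a set of functions $f:\mathbf R^d\to\mathbf R$ with $\sup_{g\in\mathcal F}\|g\|_2\le B_2$, $0<B_2<\infty$ (signal functions in the Gaussian white noise model, probability densities in the density estimation model). Let $\delta>0$, let $\mathcal F_\delta$ be a finite $\delta$-net of $\mathcal F$ in the $L_2$ metric, and let $\hat f=\operatorname{argmin}_{\phi\in\mathcal F_\delta}\gamma_n(\phi)$ be the $\delta$-net estimator. In the density estimation model assume in addition that $$\varrho(Q,\mathcal F_\delta)\ge 1,\qquad \sup_{f\in\mathcal F}\|Af\|_\infty\le B_\infty,\qquad \sup_{f\in\mathcal F}\|Qf\|_\infty\le B_\infty',$$ where $0<B_\infty,B_\infty'<\infty$. Let $C_\tau>0$ and let $\xi$ be such that $$C_\tau^{-1}\Big(\tfrac{4B_\infty'}{3}+\sqrt{2\big[\tfrac{8(B_\infty')^2}{9}+C_\tau B_\infty\big]}\Big)\le\xi<\tfrac12\quad\text{(density estimation)},$$ $$\sqrt{2/C_\tau}\le\xi<\tfrac12\quad\text{(Gaussian white noise)}.$$ Then, in each of the two models, for every true $f\in\mathcal F$, $$E\|\hat f-f\|_2^2\le C_1\delta^2+C_2\,\frac{\varrho^2(Q,\mathcal F_\delta)\,\big(\log_e(\#\mathcal F_\delta)+1\big)}{n},$$ where $C_1=(1-2\xi)^{-1}(1+2\xi)$ and $C_2=(1-2\xi)^{-1}\xi C_\tau$.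
   Context: Setting. $(\mathbf Y,\mathcal Y,\nu)$ is a Borel space with measure $\nu$; $A:L_2(\mathbf R^d)\to L_2(\mathbf Y,\nu)$ is a known linear operator with inverse $A^{-1}$, and $Q=(A^{-1})^*$ is the adjoint of the inverse, with domain $L_2(\mathbf R^d)$, satisfying $\int_{\mathbf R^d}(A^{-1}h)\,g=\int_{\mathbf Y}h\,(Qg)\,d\nu$ for $h\in L_2(\mathbf Y,\nu)$, $g\in L_2(\mathbf R^d)$. Gaussian white noise model: one observes $dY_n=(Af)\,d\nu+n^{-1/2}dW$ on $\mathbf Y$, where $W$ is the Brownian process on $\mathbf Y$: for $h_1,h_2\in L_2(\mathbf Y,\nu)$ the vector $(\int h_1dW,\int h_2dW)$ is centered Gaussian with variances $\|h_1\|_{2,\nu}^2,\|h_2\|_{2,\nu}^2$ and covariance $\int h_1h_2\,d\nu$. Density estimation model: one observes i.i.d. $Y_1,\dots,Y_n\in\mathbf Y$ with common density $Af$, where $f$ is a probability density on $\mathbf R^d$. Empirical risk: $\gamma_n(g)=-2\int_{\mathbf Y}(Qg)\,dY_n+\|g\|_2^2$ (white noise), $\gamma_n(g)=-2n^{-1}\sum_{i=1}^n(Qg)(Y_i)+\|g\|_2^2$ (density estimation). A $\delta$-net of $\mathcal F$ is a set $\mathcal F_\delta$ such that for each $f\in\mathcal F$ there is $\phi\in\mathcal F_\delta$ with $\|f-\phi\|_2\le\delta$. Operator norm over the net: $$\varrho(Q,\mathcal F_\delta)=\max_{\phi,\phi'\in\mathcal F_\delta,\ \phi\ne\phi'}\frac{\|Q(\phi-\phi')\|_2}{\|\phi-\phi'\|_2},$$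 where $\|\cdot\|_2$ of a function on $\mathbf Y$ is the $L_2(\nu)$ norm. $\#$ denotes cardinality. $E$ is expectation under the true $f$.
   Formalization: In the density estimation model the bound ‖Qφ‖_∞ ≤ B_∞' is also required for every φ in the δ-net F_δ (automatic when F_δ is a subset of F); without it the claim fails for nets that leave F. *)

theory Defs
  imports "HOL-Probability.Probability"
begin

text \<open>
  Elements of \<open>L\<^sub>2\<close> and \<open>L\<^sub>\<infinity>\<close> are represented by functions rather than by classes modulo
  almost-everywhere equality; all notions below are invariant under changing
  representatives, except that two representatives of one class count as different
  members of a net.
\<close>

definition L2 :: "'a measure \<Rightarrow> ('a \<Rightarrow> real) set" where
  "L2 M = {g. g \<in> borel_measurable M \<and> integrable M (\<lambda>x. (g x)\<^sup>2)}"

definition l2_norm :: "'a measure \<Rightarrow> ('a \<Rightarrow> real) \<Rightarrow> real" where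
  "l2_norm M g = sqrt (\<integral>x. (g x)\<^sup>2 \<partial>M)"

definition linf_norm :: "'a measure \<Rightarrow> ('a \<Rightarrow> real) \<Rightarrow> ereal" where
  "linf_norm M g = esssup M (\<lambda>x. ereal \<bar>g x\<bar>)"

text \<open>The second clause says that the operator is well defined on classes.\<close>

definition linear_L2 :: "'a measure \<Rightarrow> 'b measure \<Rightarrow> (('a \<Rightarrow> real) \<Rightarrow> 'b \<Rightarrow> real) \<Rightarrow> bool" where
  "linear_L2 M N T \<longleftrightarrow>
     (\<forall>g\<in>L2 M. T g \<in> L2 N) \<and>
     (\<forall>g\<in>L2 M. \<forall>h\<in>L2 M. (AE x in M. g x = h x) \<longrightarrow> (AE y in N. T g y = T h y)) \<and>
     (\<forall>g\<in>L2 M. \<forall>h\<in>L2 M. \<forall>a b.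
        AE y in N. T (\<lambda>x. a * g x + b * h x) y = a * T g y + b * T h y)"

definition inverse_L2 :: "'a measure \<Rightarrow> 'b measure \<Rightarrow> (('a \<Rightarrow> real) \<Rightarrow> 'b \<Rightarrow> real) \<Rightarrow>
    (('b \<Rightarrow> real) \<Rightarrow> 'a \<Rightarrow> real) \<Rightarrow> bool" where
  "inverse_L2 M N T S \<longleftrightarrow> linear_L2 N M S \<and>
     (\<forall>g\<in>L2 M. AE x in M. S (T g) x = g x) \<and>
     (\<forall>h\<in>L2 N. AE y in N. T (S h) y = h y)"

definition adjoint_L2 :: "'a measure \<Rightarrow> 'b measure \<Rightarrow> (('a \<Rightarrow> real) \<Rightarrow> 'b \<Rightarrow> real) \<Rightarrow>
    (('b \<Rightarrow> real) \<Rightarrow> 'a \<Rightarrow> real) \<Rightarrow> bool" where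
  "adjoint_L2 M N T S \<longleftrightarrow>
     (\<forall>g\<in>L2 N. S g \<in> L2 M) \<and>
     (\<forall>h\<in>L2 M. \<forall>g\<in>L2 N. (\<integral>y. T h y * g y \<partial>N) = (\<integral>x. h x * S g x \<partial>M))"

text \<open>
  The net need not be contained in the set it approximates; boundedness of an operator on the
  set therefore does not carry over to the net automatically.
\<close>

definition delta_net :: "'a measure \<Rightarrow> real \<Rightarrow> ('a \<Rightarrow> real) set \<Rightarrow> ('a \<Rightarrow> real) set \<Rightarrow> bool" where
  "delta_net M \<delta> F N \<longleftrightarrow>
     N \<subseteq> L2 M \<and> (\<forall>f\<in>F. \<exists>\<phi>\<in>N. l2_norm M (\<lambda>x. f x - \<phi> x) \<le> \<delta>)"

text \<open>
  Inserting \<open>0\<close> only fixes the value for a net with one element, where there is no pair to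
  maximise over: all quotients are nonnegative.  The quotient of two representatives of the
  same class is \<open>0 / 0 = 0\<close>.
\<close>

definition net_op_norm :: "'a measure \<Rightarrow> 'b measure \<Rightarrow> (('a \<Rightarrow> real) \<Rightarrow> 'b \<Rightarrow> real) \<Rightarrow>
    ('a \<Rightarrow> real) set \<Rightarrow> real" where
  "net_op_norm M \<nu> Q N =
     Max (insert 0 {l2_norm \<nu> (Q (\<lambda>x. \<phi> x - \<phi>' x)) / l2_norm M (\<lambda>x. \<phi> x - \<phi>' x) | \<phi> \<phi>'.
       \<phi> \<in> N \<and> \<phi>' \<in> N \<and> \<phi> \<noteq> \<phi>'})"

definition centered_normal :: "real \<Rightarrow> real measure" where
  "centered_normal v =
     (if v = 0 then return borel 0
      else density lborel (\<lambda>x. ennreal (normal_density 0 (sqrt v) x)))"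

text \<open>
  A random vector is Gaussian iff all linear combinations of its components are Gaussian,
  possibly degenerate.  Here \<open>v\<^sub>1\<close>, \<open>v\<^sub>2\<close> are the variances and \<open>c\<close> is the covariance.
\<close>

definition centered_gaussian_pair :: "'w measure \<Rightarrow> ('w \<Rightarrow> real) \<Rightarrow> ('w \<Rightarrow> real) \<Rightarrow>
    real \<Rightarrow> real \<Rightarrow> real \<Rightarrow> bool" where
  "centered_gaussian_pair M X Y v\<^sub>1 v\<^sub>2 c \<longleftrightarrow>
     X \<in> borel_measurable M \<and> Y \<in> borel_measurable M \<and>
     (\<forall>a b. distr M borel (\<lambda>\<omega>. a * X \<omega> + b * Y \<omega>) =
            centered_normal (a\<^sup>2 * v\<^sub>1 + 2 * a * b * c + b\<^sup>2 * v\<^sub>2))"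

text \<open>\<open>W h\<close> stands for the stochastic integral of \<open>h\<close> with respect to the Brownian process.\<close>

definition brownian_process :: "'w measure \<Rightarrow> 'b measure \<Rightarrow> (('b \<Rightarrow> real) \<Rightarrow> 'w \<Rightarrow> real) \<Rightarrow> bool" where
  "brownian_process M \<nu> W \<longleftrightarrow>
     (\<forall>h\<^sub>1\<in>L2 \<nu>. \<forall>h\<^sub>2\<in>L2 \<nu>.
        centered_gaussian_pair M (W h\<^sub>1) (W h\<^sub>2)
          ((l2_norm \<nu> h\<^sub>1)\<^sup>2) ((l2_norm \<nu> h\<^sub>2)\<^sup>2) (\<integral>y. h\<^sub>1 y * h\<^sub>2 y \<partial>\<nu>))"

text \<open>The integral of \<open>h\<close> with respect to \<open>dY\<^sub>n = s d\<nu> + n\<^sup>-\<^sup>1\<^sup>/\<^sup>2 dW\<close>.\<close>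

definition white_noise_obs :: "'b measure \<Rightarrow> (('b \<Rightarrow> real) \<Rightarrow> 'w \<Rightarrow> real) \<Rightarrow> nat \<Rightarrow> ('b \<Rightarrow> real) \<Rightarrow>
    ('b \<Rightarrow> real) \<Rightarrow> 'w \<Rightarrow> real" where
  "white_noise_obs \<nu> W n s h \<omega> = (\<integral>y. h y * s y \<partial>\<nu>) + W h \<omega> / sqrt (real n)"

definition white_noise_risk :: "'a measure \<Rightarrow> (('a \<Rightarrow> real) \<Rightarrow> 'b \<Rightarrow> real) \<Rightarrow>
    (('b \<Rightarrow> real) \<Rightarrow> 'w \<Rightarrow> real) \<Rightarrow> ('a \<Rightarrow> real) \<Rightarrow> 'w \<Rightarrow> real" where
  "white_noise_risk L Q Y g \<omega> = - 2 * Y (Q g) \<omega> + (l2_norm L g)\<^sup>2"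

definition prob_density :: "'a measure \<Rightarrow> ('a \<Rightarrow> real) \<Rightarrow> bool" where
  "prob_density M p \<longleftrightarrow>
     p \<in> borel_measurable M \<and> (AE x in M. 0 \<le> p x) \<and> (\<integral>\<^sup>+x. ennreal (p x) \<partial>M) = 1"

definition iid_sample :: "'w measure \<Rightarrow> 'b measure \<Rightarrow> nat \<Rightarrow> ('b \<Rightarrow> real) \<Rightarrow> (nat \<Rightarrow> 'w \<Rightarrow> 'b) \<Rightarrow> bool" where
  "iid_sample M \<nu> n p Y \<longleftrightarrow>
     prob_density \<nu> p \<and>
     prob_space.indep_vars M (\<lambda>_. \<nu>) Y {1..n} \<and>
     (\<forall>i\<in>{1..n}. distributed M \<nu> (Y i) (\<lambda>y. ennreal (p y)))"

definition density_risk :: "'a measure \<Rightarrow> (('a \<Rightarrow> real) \<Rightarrow> 'b \<Rightarrow> real) \<Rightarrow> nat \<Rightarrow>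
    (nat \<Rightarrow> 'w \<Rightarrow> 'b) \<Rightarrow> ('a \<Rightarrow> real) \<Rightarrow> 'w \<Rightarrow> real" where
  "density_risk L Q n Y g \<omega> = - 2 / real n * (\<Sum>i=1..n. Q g (Y i \<omega>)) + (l2_norm L g)\<^sup>2"

text \<open>
  A minimiser need not be unique; any measurable selection of minimisers is an estimator.
\<close>

definition net_estimator :: "'w measure \<Rightarrow> (('a \<Rightarrow> real) \<Rightarrow> 'w \<Rightarrow> real) \<Rightarrow> ('a \<Rightarrow> real) set \<Rightarrow>
    ('w \<Rightarrow> 'a \<Rightarrow> real) \<Rightarrow> bool" where
  "net_estimator M \<gamma> N fhat \<longleftrightarrow>
     fhat \<in> measurable M (count_space N) \<and>
     (\<forall>\<omega>\<in>space M. is_arg_min (\<lambda>\<phi>. \<gamma> \<phi> \<omega>) (\<lambda>\<phi>. \<phi> \<in> N) (fhat \<omega>))"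

end

theory Submission
  imports Defs
begin

text \<open>
  Let \<open>\<phi>\<^sub>0\<close> be a net point within \<open>\<delta>\<close> of \<open>f\<close>. Since \<open>Q\<close> is the adjoint of the inverse of \<open>A\<close>, the empirical
  risk is an unbiased estimate of \<open>\<parallel>\<phi> - f\<parallel>\<^sup>2 - \<parallel>f\<parallel>\<^sup>2\<close>; write \<open>X \<phi>\<close> for its negated centred noise. Minimality
  of the estimator and \<open>\<parallel>\<phi> - \<phi>\<^sub>0\<parallel>\<^sup>2 \<le> 2 \<parallel>\<phi> - f\<parallel>\<^sup>2 + 2 \<parallel>f - \<phi>\<^sub>0\<parallel>\<^sup>2\<close> bound \<open>(1 - 2\<xi>)\<close> times the loss by
  \<open>(1 + 2\<xi>) \<delta>\<^sup>2\<close> plus the value at \<open>\<phi> = fhat\<close> of \<open>Z \<phi> = X \<phi> - X \<phi>\<^sub>0 - \<xi> \<parallel>\<phi> - \<phi>\<^sub>0\<parallel>\<^sup>2\<close>. The increments of \<open>X\<close> have variance proxy of order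
  \<open>\<varrho>\<^sup>2 \<parallel>\<phi> - \<phi>\<^sub>0\<parallel>\<^sup>2 / n\<close> (exactly in the Gaussian model, by Bernstein's exponential moment bound in the density
  model), so \<open>exp (\<theta> Z \<phi>)\<close> has mean at most \<open>1\<close> for \<open>\<theta>\<close> of order \<open>n / \<varrho>\<^sup>2\<close>, and therefore the maximum of \<open>Z\<close> over
  the net has mean at most \<open>ln (card N) / \<theta>\<close>.
\<close>

subsection \<open>Square-integrable functions\<close>

lemma L2_D:
  assumes "g \<in> L2 M"
  shows "g \<in> borel_measurable M" "integrable M (\<lambda>x. (g x)\<^sup>2)"
  using assms by (auto simp: L2_def)

lemma L2_mult_integrable:
  assumes "g \<in> L2 M" "h \<in> L2 M"
  shows "integrable M (\<lambda>x. g x * h x)"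
proof (rule Bochner_Integration.integrable_bound)
  show "integrable M (\<lambda>x. (g x)\<^sup>2 + (h x)\<^sup>2)"
    using assms by (auto dest: L2_D)
  show "(\<lambda>x. g x * h x) \<in> borel_measurable M"
    using assms by (intro borel_measurable_times L2_D)
  have "\<bar>g x * h x\<bar> \<le> (g x)\<^sup>2 + (h x)\<^sup>2" for x
  proof -
    have "0 \<le> (\<bar>g x\<bar> - \<bar>h x\<bar>)\<^sup>2" "0 \<le> (g x)\<^sup>2 + (h x)\<^sup>2" by simp_all
    then show ?thesis unfolding power2_diff abs_mult power2_abs by linarith
  qed
  then show "AE x in M. norm (g x * h x) \<le> norm ((g x)\<^sup>2 + (h x)\<^sup>2)"
    by (simp add: abs_of_nonneg)
qed

lemma L2_diff:
  assumes "g \<in> L2 M" "h \<in> L2 M"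
  shows "(\<lambda>x. g x - h x) \<in> L2 M"
  using L2_mult_integrable[OF assms] assms
  by (auto simp: L2_def power2_diff mult.assoc)

lemma l2_norm_nonneg: "0 \<le> l2_norm M g"
  by (simp add: l2_norm_def)

lemma l2_norm_sq: "(l2_norm M g)\<^sup>2 = (\<integral>x. (g x)\<^sup>2 \<partial>M)"
  by (simp add: l2_norm_def)

lemma l2_norm_diff_sq:
  assumes "g \<in> L2 M" "h \<in> L2 M"
  shows "(l2_norm M (\<lambda>x. g x - h x))\<^sup>2 =
    (l2_norm M g)\<^sup>2 + (l2_norm M h)\<^sup>2 - 2 * (\<integral>x. g x * h x \<partial>M)"
  using assms L2_mult_integrable[OF assms]
  by (simp add: l2_norm_sq power2_diff L2_D mult.assoc)

text \<open>The squared triangle inequality, from \<open>((g - h) - (h - k))\<^sup>2 \<ge> 0\<close>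
  pointwise. Its factors 2 are the source of the terms 2\<xi> in the final constants.\<close>

lemma l2_norm_diff_sq_le:
  assumes "g \<in> L2 M" "h \<in> L2 M" "k \<in> L2 M"
  shows "(l2_norm M (\<lambda>x. g x - k x))\<^sup>2 \<le>
    2 * (l2_norm M (\<lambda>x. g x - h x))\<^sup>2 + 2 * (l2_norm M (\<lambda>x. h x - k x))\<^sup>2"
proof -
  have int: "integrable M (\<lambda>x. (g x - h x)\<^sup>2)" "integrable M (\<lambda>x. (h x - k x)\<^sup>2)"
    "integrable M (\<lambda>x. (g x - k x)\<^sup>2)"
    using L2_D(2)[OF L2_diff] assms by blast+
  have "(g x - k x)\<^sup>2 \<le> 2 * (g x - h x)\<^sup>2 + 2 * (h x - k x)\<^sup>2" for x
  proof -
    have "0 \<le> ((g x - h x) - (h x - k x))\<^sup>2" by simp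
    then show ?thesis by (simp add: power2_eq_square algebra_simps)
  qed
  then have "(\<integral>x. (g x - k x)\<^sup>2 \<partial>M) \<le> (\<integral>x. 2 * (g x - h x)\<^sup>2 + 2 * (h x - k x)\<^sup>2 \<partial>M)"
    using int by (intro integral_mono) auto
  then show ?thesis using int by (simp add: l2_norm_sq)
qed

lemma l2_norm_eq_0_iff:
  assumes "g \<in> L2 M"
  shows "l2_norm M g = 0 \<longleftrightarrow> (AE x in M. g x = 0)"
  using assms integral_nonneg_eq_0_iff_AE[of M "\<lambda>x. (g x)\<^sup>2"]
  by (simp add: l2_norm_def L2_D)

lemma linf_norm_AE_le:
  assumes "linf_norm M g \<le> ereal B"
  shows "AE x in M. \<bar>g x\<bar> \<le> B"
proof -
  have "AE x in M. ereal \<bar>g x\<bar> \<le> linf_norm M g"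
    unfolding linf_norm_def by (rule esssup_AE)
  then show ?thesis
  proof eventually_elim
    case (elim x)
    then have "ereal \<bar>g x\<bar> \<le> ereal B" using assms by (rule order_trans)
    then show ?case by simp
  qed
qed

subsection \<open>Adjoint operators and the net operator norm\<close>

text \<open>\<open>adjoint_L2\<close> does not state additivity of \<open>S\<close>; it follows by
  duality. The defect \<open>e\<close> lies in L2, and passing to \<open>T e\<close> turns its
  squared norm into the integral of \<open>T e\<close> against (g - h) - (g - h).\<close>

lemma adjoint_L2_diff:
  assumes T: "linear_L2 M N T" and adj: "adjoint_L2 M N T S"
    and g: "g \<in> L2 N" and h: "h \<in> L2 N"
  shows "AE x in M. S (\<lambda>y. g y - h y) x = S g x - S h x"
proof -
  have S: "S k \<in> L2 M" if "k \<in> L2 N" for k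
    using adj that by (auto simp: adjoint_L2_def)
  have pair: "(\<integral>x. k x * S l x \<partial>M) = (\<integral>y. T k y * l y \<partial>N)" if "k \<in> L2 M" "l \<in> L2 N" for k l
    using adj that by (auto simp: adjoint_L2_def)
  define e where "e x = S (\<lambda>y. g y - h y) x - (S g x - S h x)" for x
  have gh: "(\<lambda>y. g y - h y) \<in> L2 N" using g h by (rule L2_diff)
  have e: "e \<in> L2 M" unfolding e_def[abs_def] by (intro L2_diff S g h gh)
  have Te: "T e \<in> L2 N" using T e by (auto simp: linear_L2_def)
  have int: "integrable M (\<lambda>x. e x * S k x)" if "k \<in> L2 N" for k
    using e S[OF that] by (rule L2_mult_integrable)
  have "(\<integral>x. (e x)\<^sup>2 \<partial>M) =
    (\<integral>x. e x * S (\<lambda>y. g y - h y) x - (e x * S g x - e x * S h x) \<partial>M)"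
    by (intro Bochner_Integration.integral_cong)
       (auto simp: e_def power2_eq_square algebra_simps)
  also have "\<dots> = (\<integral>y. T e y * (g y - h y) \<partial>N) - ((\<integral>y. T e y * g y \<partial>N) - (\<integral>y. T e y * h y \<partial>N))"
    using int[OF g] int[OF h] int[OF gh] by (simp add: pair e g h gh)
  also have "\<dots> = 0"
    using L2_mult_integrable[OF Te g] L2_mult_integrable[OF Te h]
    by (simp add: right_diff_distrib)
  finally have "l2_norm M e = 0" by (simp add: l2_norm_def)
  then have "AE x in M. e x = 0" using l2_norm_eq_0_iff[OF e] by simp
  then show ?thesis by eventually_elim (simp add: e_def)
qed

text \<open>Pairing \<open>S g\<close> with itself writes its squared norm as an integral against
  \<open>g\<close>, which vanishes almost everywhere. This settles pairs of net points that
  represent the same class.\<close>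

lemma adjoint_L2_null:
  assumes adj: "adjoint_L2 M N T S"
    and g: "g \<in> L2 N" and 0: "l2_norm N g = 0"
  shows "l2_norm M (S g) = 0"
proof -
  have S: "S g \<in> L2 M" using adj g by (auto simp: adjoint_L2_def)
  have "AE y in N. g y = 0" using l2_norm_eq_0_iff[OF g] 0 by simp
  then have "AE y in N. T (S g) y * g y = 0" by eventually_elim simp
  then have "(\<integral>y. T (S g) y * g y \<partial>N) = 0" by (rule integral_eq_zero_AE)
  then have "(\<integral>x. S g x * S g x \<partial>M) = 0"
    using adj S g by (auto simp: adjoint_L2_def)
  then show ?thesis by (simp add: l2_norm_def power2_eq_square)
qed

lemma finite_net_quotients:
  assumes "finite N"
  shows "finite {q \<phi> \<phi>' | \<phi> \<phi>'. \<phi> \<in> N \<and> \<phi>' \<in> N \<and> \<phi> \<noteq> \<phi>'}"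
proof (rule finite_subset)
  show "{q \<phi> \<phi>' | \<phi> \<phi>'. \<phi> \<in> N \<and> \<phi>' \<in> N \<and> \<phi> \<noteq> \<phi>'} \<subseteq> (\<lambda>(\<phi>, \<phi>'). q \<phi> \<phi>') ` (N \<times> N)"
    by auto
qed (use assms in simp)

lemma net_op_norm_nonneg: "finite N \<Longrightarrow> 0 \<le> net_op_norm M \<nu> Q N"
  unfolding net_op_norm_def by (intro Max_ge) (auto intro!: finite_net_quotients)

text \<open>The quotients contain \<open>Q\<close> of a difference, the risks a difference of
  images; additivity of the adjoint makes the two norms equal. For two representatives of one class
  the quotient 0/0 gives no information, so the image norm is shown to be 0 directly.\<close>

lemma net_op_norm_bound:
  assumes T: "linear_L2 \<nu> M T" and adj: "adjoint_L2 \<nu> M T Q"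
    and N: "finite N" "N \<subseteq> L2 M" and \<phi>: "\<phi> \<in> N" "\<phi>' \<in> N"
  shows "l2_norm \<nu> (\<lambda>y. Q \<phi> y - Q \<phi>' y) \<le> net_op_norm M \<nu> Q N * l2_norm M (\<lambda>x. \<phi> x - \<phi>' x)"
proof -
  let ?d = "l2_norm M (\<lambda>x. \<phi> x - \<phi>' x)" and ?Qd = "l2_norm \<nu> (Q (\<lambda>x. \<phi> x - \<phi>' x))"
  have L2: "\<phi> \<in> L2 M" "\<phi>' \<in> L2 M" using N \<phi> by auto
  then have dL2: "(\<lambda>x. \<phi> x - \<phi>' x) \<in> L2 M" by (rule L2_diff)
  have Q: "Q g \<in> L2 \<nu>" if "g \<in> L2 M" for g
    using adj that by (auto simp: adjoint_L2_def)
  have "AE y in \<nu>. (Q \<phi> y - Q \<phi>' y)\<^sup>2 = (Q (\<lambda>x. \<phi> x - \<phi>' x) y)\<^sup>2"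
    using adjoint_L2_diff[OF T adj L2] by eventually_elim simp
  then have "(\<integral>y. (Q \<phi> y - Q \<phi>' y)\<^sup>2 \<partial>\<nu>) = (\<integral>y. (Q (\<lambda>x. \<phi> x - \<phi>' x) y)\<^sup>2 \<partial>\<nu>)"
    using L2_D(1)[OF Q[OF dL2]] L2_D(1)[OF Q[OF L2(1)]] L2_D(1)[OF Q[OF L2(2)]]
    by (intro integral_cong_AE) auto
  then have eq: "l2_norm \<nu> (\<lambda>y. Q \<phi> y - Q \<phi>' y) = ?Qd"
    by (simp add: l2_norm_def)
  show ?thesis
  proof (cases "?d = 0")
    case True
    then have "?Qd = 0" using adjoint_L2_null[OF adj dL2] by simp
    then show ?thesis using eq True by simp
  next
    case False
    then have "\<phi> \<noteq> \<phi>'" by (auto simp: l2_norm_def)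
    then have "?Qd / ?d \<le> net_op_norm M \<nu> Q N"
      unfolding net_op_norm_def using N \<phi>
      by (intro Max_ge) (auto intro!: finite_net_quotients)
    moreover have "0 < ?d" using False l2_norm_nonneg[of M "\<lambda>x. \<phi> x - \<phi>' x"] by simp
    ultimately show ?thesis using eq by (simp add: pos_divide_le_eq)
  qed
qed

subsection \<open>Exponential moments\<close>

text \<open>Completing the square: exponential tilting of a centred normal density shifts its mean
  to \<open>t * \<sigma>\<^sup>2\<close>.\<close>

lemma normal_density_exp_mult:
  assumes "0 < \<sigma>"
  shows "normal_density 0 \<sigma> x * exp (t * x) = exp (t\<^sup>2 * \<sigma>\<^sup>2 / 2) * normal_density (t * \<sigma>\<^sup>2) \<sigma> x"
proof -
  have "- x\<^sup>2 / (2 * \<sigma>\<^sup>2) + t * x = t\<^sup>2 * \<sigma>\<^sup>2 / 2 + - (x - t * \<sigma>\<^sup>2)\<^sup>2 / (2 * \<sigma>\<^sup>2)"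
    using assms by (simp add: field_simps power2_eq_square)
  then have "exp (- x\<^sup>2 / (2 * \<sigma>\<^sup>2)) * exp (t * x) =
    exp (t\<^sup>2 * \<sigma>\<^sup>2 / 2) * exp (- (x - t * \<sigma>\<^sup>2)\<^sup>2 / (2 * \<sigma>\<^sup>2))"
    by (simp only: exp_add[symmetric])
  then show ?thesis by (simp add: normal_density_def)
qed

text \<open>The tilted density again integrates to 1, so only the factor from completing the square
  remains. Variance 0 is the point mass at 0 and is treated apart.\<close>

lemma has_bochner_integral_exp_centered_normal:
  assumes "0 \<le> v"
  shows "has_bochner_integral (centered_normal v) (\<lambda>x. exp (t * x)) (exp (t\<^sup>2 * v / 2))"
proof (cases "v = 0")
  case True
  have "has_bochner_integral (return borel (0::real)) (\<lambda>x. exp (t * x)) (exp (t * 0))"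
    by (subst has_bochner_integral_iff)
       (auto simp: integral_return integrable_iff_bounded nn_integral_return)
  then show ?thesis using True by (simp add: centered_normal_def)
next
  case False
  then have \<sigma>: "0 < sqrt v" using assms by simp
  have "has_bochner_integral lborel (\<lambda>x. exp (t\<^sup>2 * v / 2) * normal_density (t * v) (sqrt v) x)
    (exp (t\<^sup>2 * v / 2) * 1)"
    using \<sigma> by (intro has_bochner_integral_mult_right) (simp add: has_bochner_integral_iff)
  then have "has_bochner_integral lborel (\<lambda>x. normal_density 0 (sqrt v) x * exp (t * x))
    (exp (t\<^sup>2 * v / 2))"
    using normal_density_exp_mult[OF \<sigma>, of _ t] assms by simp
  then show ?thesis using False
    by (auto simp: centered_normal_def intro!: has_bochner_integral_density)
qed

text \<open>What is given is the law of each linear combination of two stochastic integrals.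
  Coefficients 1 and -1 yield the law of the difference, and its variance is the expanded squared
  norm of \<open>h\<^sub>1 - h\<^sub>2\<close>.\<close>

lemma has_bochner_integral_exp_brownian:
  assumes W: "brownian_process M \<nu> W" and h: "h\<^sub>1 \<in> L2 \<nu>" "h\<^sub>2 \<in> L2 \<nu>"
  shows "has_bochner_integral M (\<lambda>\<omega>. exp (t * (W h\<^sub>1 \<omega> - W h\<^sub>2 \<omega>)))
    (exp (t\<^sup>2 * (l2_norm \<nu> (\<lambda>y. h\<^sub>1 y - h\<^sub>2 y))\<^sup>2 / 2))"
proof -
  let ?v = "(l2_norm \<nu> (\<lambda>y. h\<^sub>1 y - h\<^sub>2 y))\<^sup>2"
  have pair: "centered_gaussian_pair M (W h\<^sub>1) (W h\<^sub>2)
    ((l2_norm \<nu> h\<^sub>1)\<^sup>2) ((l2_norm \<nu> h\<^sub>2)\<^sup>2) (\<integral>y. h\<^sub>1 y * h\<^sub>2 y \<partial>\<nu>)"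
    using W h by (auto simp: brownian_process_def)
  then have [measurable]: "W h\<^sub>1 \<in> borel_measurable M" "W h\<^sub>2 \<in> borel_measurable M"
    by (auto simp: centered_gaussian_pair_def)
  have "distr M borel (\<lambda>\<omega>. 1 * W h\<^sub>1 \<omega> + (- 1) * W h\<^sub>2 \<omega>) =
    centered_normal (1\<^sup>2 * (l2_norm \<nu> h\<^sub>1)\<^sup>2 + 2 * 1 * (- 1) * (\<integral>y. h\<^sub>1 y * h\<^sub>2 y \<partial>\<nu>)
      + (- 1)\<^sup>2 * (l2_norm \<nu> h\<^sub>2)\<^sup>2)"
    using pair unfolding centered_gaussian_pair_def by blast
  then have distr: "distr M borel (\<lambda>\<omega>. W h\<^sub>1 \<omega> - W h\<^sub>2 \<omega>) = centered_normal ?v"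
    unfolding l2_norm_diff_sq[OF h] by (simp add: algebra_simps)
  have "has_bochner_integral (distr M borel (\<lambda>\<omega>. W h\<^sub>1 \<omega> - W h\<^sub>2 \<omega>)) (\<lambda>x. exp (t * x))
    (exp (t\<^sup>2 * ?v / 2))"
    unfolding distr by (rule has_bochner_integral_exp_centered_normal) simp
  then show ?thesis
    by (simp add: has_bochner_integral_iff integrable_distr_eq integral_distr)
qed

text \<open>Since (n + 2)! is at least 2 * 3^n, the exponential series from the quadratic term on is
  dominated by x^2 / 2 times a geometric series of ratio K / 3.\<close>

lemma exp_le_bernstein:
  fixes x K :: real
  assumes "\<bar>x\<bar> \<le> K" "K < 3"
  shows "exp x \<le> 1 + x + x\<^sup>2 / (2 * (1 - K / 3))"
proof -
  have fact: "2 * 3 ^ n \<le> (fact (n + 2) :: real)" for n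
  proof (induction n)
    case (Suc n)
    have "2 * 3 ^ Suc n = 3 * (2 * 3 ^ n :: real)" by simp
    also have "\<dots> \<le> (3 + real n) * fact (n + 2)"
      using Suc by (intro mult_mono) auto
    finally show ?case by (simp add: algebra_simps)
  qed (simp add: numeral_2_eq_2)
  have K: "0 \<le> K" using assms by linarith
  have sum: "(\<lambda>n. (x\<^sup>2 / 2) * (K / 3) ^ n) sums ((x\<^sup>2 / 2) * (1 / (1 - K / 3)))"
    using K assms by (intro sums_mult geometric_sums) simp
  have le: "inverse (fact (n + 2)) *\<^sub>R x ^ (n + 2) \<le> (x\<^sup>2 / 2) * (K / 3) ^ n" for n
  proof -
    have "x ^ (n + 2) \<le> x\<^sup>2 * K ^ n"
    proof -
      have "x ^ n \<le> K ^ n"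
        using power_mono[OF assms(1), of n] by (auto intro: order_trans[OF abs_ge_self] simp: power_abs)
      then show ?thesis unfolding power_add by (subst mult.commute) (auto intro: mult_left_mono)
    qed
    then have "inverse (fact (n + 2)) *\<^sub>R x ^ (n + 2) \<le> (x\<^sup>2 * K ^ n) / fact (n + 2)"
      by (simp add: divide_simps)
    also have "\<dots> \<le> (x\<^sup>2 * K ^ n) / (2 * 3 ^ n)"
      using K fact[of n] by (intro divide_left_mono) auto
    finally show ?thesis by (simp add: power_divide)
  qed
  have "summable (\<lambda>n. inverse (fact (n + 2)) *\<^sub>R x ^ (n + 2))"
    using summable_exp_generic[of x] summable_iff_shift[of "\<lambda>n. inverse (fact n) *\<^sub>R x ^ n" 2]
    by simp
  then have "(\<Sum>n. inverse (fact (n + 2)) *\<^sub>R x ^ (n + 2)) \<le> (\<Sum>n. (x\<^sup>2 / 2) * (K / 3) ^ n)"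
    using sum by (intro suminf_le le) (auto simp: sums_iff)
  also have "\<dots> = x\<^sup>2 / (2 * (1 - K / 3))" using sum by (simp add: sums_iff)
  finally show ?thesis using exp_first_two_terms[of x] by simp
qed

text \<open>\<open>exp_le_bernstein\<close> is applied to the uncentred \<open>s * U\<close> and
  integrated, so \<open>b\<close> bounds \<open>U\<close> itself and \<open>V\<close> its second
  moment. The mean then enters an exponential through 1 + y \<le> exp y and is cancelled by the
  factor from centring.\<close>

lemma (in prob_space) bernstein_exp_moment:
  fixes U :: "'a \<Rightarrow> real" and b s V :: real
  assumes U: "U \<in> borel_measurable M" "AE \<omega> in M. \<bar>U \<omega>\<bar> \<le> b"
    and V: "expectation (\<lambda>\<omega>. (U \<omega>)\<^sup>2) \<le> V" and s: "0 \<le> s" "s * b < 3"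
  shows "integrable M (\<lambda>\<omega>. exp (s * (U \<omega> - expectation U)))"
    and "expectation (\<lambda>\<omega>. exp (s * (U \<omega> - expectation U))) \<le> exp (s\<^sup>2 * V / (2 * (1 - s * b / 3)))"
proof -
  note [measurable] = U(1)
  let ?k = "2 * (1 - s * b / 3)"
  have k: "0 < ?k" using s by (simp add: mult.commute)
  have intU: "integrable M U"
    using U by (intro integrable_const_bound[of _ b]) auto
  have intU2: "integrable M (\<lambda>\<omega>. (U \<omega>)\<^sup>2)"
    using U by (intro integrable_const_bound[of _ "b\<^sup>2"]) (auto elim!: eventually_mono intro: abs_le_square_iff[THEN iffD1])
  have intE: "integrable M (\<lambda>\<omega>. exp (s * U \<omega>))"
  proof (rule integrable_const_bound[of _ "exp (s * b)"])
    show "AE \<omega> in M. norm (exp (s * U \<omega>)) \<le> exp (s * b)"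
      using U(2) by eventually_elim (use s in \<open>auto intro!: mult_left_mono\<close>)
  qed simp
  have *: "exp (s * (U \<omega> - expectation U)) = exp (s * U \<omega>) * exp (- s * expectation U)" for \<omega>
    by (simp add: exp_add[symmetric] algebra_simps)
  show "integrable M (\<lambda>\<omega>. exp (s * (U \<omega> - expectation U)))"
    unfolding * using intE by simp
  have "expectation (\<lambda>\<omega>. exp (s * U \<omega>)) \<le> expectation (\<lambda>\<omega>. 1 + s * U \<omega> + s\<^sup>2 * (U \<omega>)\<^sup>2 / ?k)"
  proof (rule integral_mono_AE[OF intE])
    show "AE \<omega> in M. exp (s * U \<omega>) \<le> 1 + s * U \<omega> + s\<^sup>2 * (U \<omega>)\<^sup>2 / ?k"
      using U(2)
    proof eventually_elim
      case (elim \<omega>)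
      then have "\<bar>s * U \<omega>\<bar> \<le> s * b" using s by (simp add: abs_mult mult_left_mono)
      from exp_le_bernstein[OF this s(2)] show ?case by (simp add: power_mult_distrib)
    qed
  qed (use intU intU2 in simp)
  also have "\<dots> = 1 + s * expectation U + s\<^sup>2 * expectation (\<lambda>\<omega>. (U \<omega>)\<^sup>2) / ?k"
    using intU intU2 by (simp add: prob_space)
  also have "\<dots> \<le> 1 + s * expectation U + s\<^sup>2 * V / ?k"
    using k V by (intro add_left_mono divide_right_mono mult_left_mono) auto
  also have "\<dots> \<le> exp (s * expectation U + s\<^sup>2 * V / ?k)"
    using exp_ge_add_one_self[of "s * expectation U + s\<^sup>2 * V / ?k"] by (simp only: add.assoc)
  finally have "expectation (\<lambda>\<omega>. exp (s * U \<omega>)) * exp (- s * expectation U)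
    \<le> exp (s * expectation U + s\<^sup>2 * V / ?k) * exp (- s * expectation U)"
    by (rule mult_right_mono) simp
  also have "\<dots> = exp (s\<^sup>2 * V / ?k)" by (simp add: exp_add[symmetric])
  finally show "expectation (\<lambda>\<omega>. exp (s * (U \<omega> - expectation U))) \<le> exp (s\<^sup>2 * V / ?k)"
    unfolding * by simp
qed

lemma (in prob_space) bernstein_exp_moment_sum:
  fixes U :: "'i \<Rightarrow> 'a \<Rightarrow> real" and b s V :: real
  assumes I: "finite I" and ind: "indep_vars (\<lambda>_. borel) U I"
    and bnd: "\<And>i. i \<in> I \<Longrightarrow> AE \<omega> in M. \<bar>U i \<omega>\<bar> \<le> b"
    and V: "\<And>i. i \<in> I \<Longrightarrow> expectation (\<lambda>\<omega>. (U i \<omega>)\<^sup>2) \<le> V"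
    and s: "0 \<le> s" "s * b < 3"
  shows "integrable M (\<lambda>\<omega>. exp (s * (\<Sum>i\<in>I. U i \<omega> - expectation (U i))))"
    and "expectation (\<lambda>\<omega>. exp (s * (\<Sum>i\<in>I. U i \<omega> - expectation (U i))))
      \<le> exp (real (card I) * (s\<^sup>2 * V / (2 * (1 - s * b / 3))))"
proof -
  let ?E = "\<lambda>i \<omega>. exp (s * (U i \<omega> - expectation (U i)))"
  have meas: "U i \<in> borel_measurable M" if "i \<in> I" for i
    using ind that by (auto simp: indep_vars_def)
  note mgf = bernstein_exp_moment[OF meas bnd V s]
  have indE: "indep_vars (\<lambda>_. borel) ?E I"
    by (rule indep_vars_compose2[OF ind]) simp
  have *: "exp (s * (\<Sum>i\<in>I. U i \<omega> - expectation (U i))) = (\<Prod>i\<in>I. ?E i \<omega>)" for \<omega>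
    using I by (simp add: sum_distrib_left exp_sum)
  show "integrable M (\<lambda>\<omega>. exp (s * (\<Sum>i\<in>I. U i \<omega> - expectation (U i))))"
    unfolding * by (rule indep_vars_integrable[OF I indE mgf(1)])
  have "expectation (\<lambda>\<omega>. \<Prod>i\<in>I. ?E i \<omega>) = (\<Prod>i\<in>I. expectation (?E i))"
    by (rule indep_vars_lebesgue_integral[OF I indE mgf(1)])
  also have "\<dots> \<le> (\<Prod>i\<in>I. exp (s\<^sup>2 * V / (2 * (1 - s * b / 3))))"
    by (intro prod_mono conjI mgf(2) integral_nonneg) auto
  finally show "expectation (\<lambda>\<omega>. exp (s * (\<Sum>i\<in>I. U i \<omega> - expectation (U i))))
      \<le> exp (real (card I) * (s\<^sup>2 * V / (2 * (1 - s * b / 3))))"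
    unfolding * prod_constant exp_of_nat_mult .
qed

subsection \<open>Minimisation over a finite net\<close>

text \<open>The exponential at the selected index is at most the sum over all of \<open>N\<close>,
  which removes the dependence of the index on the data. A tangent line stands in for Jensen's
  inequality, so only the exponentials have to be integrated.\<close>

lemma (in prob_space) expectation_selection_le:
  fixes Z :: "'f \<Rightarrow> 'a \<Rightarrow> real" and G :: "'f \<Rightarrow> real"
  assumes N: "finite N" and fhat: "fhat \<in> measurable M (count_space N)" and \<theta>: "0 < \<theta>"
    and int: "\<And>\<phi>. \<phi> \<in> N \<Longrightarrow> integrable M (\<lambda>\<omega>. exp (\<theta> * Z \<phi> \<omega>))"
    and le1: "\<And>\<phi>. \<phi> \<in> N \<Longrightarrow> expectation (\<lambda>\<omega>. exp (\<theta> * Z \<phi> \<omega>)) \<le> 1"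
    and G: "\<And>\<omega>. \<omega> \<in> space M \<Longrightarrow> G (fhat \<omega>) \<le> a + Z (fhat \<omega>) \<omega>"
  shows "expectation (\<lambda>\<omega>. G (fhat \<omega>)) \<le> a + ln (real (card N)) / \<theta>"
proof -
  define D where "D = real (card N)"
  have fN: "fhat \<omega> \<in> N" if "\<omega> \<in> space M" for \<omega>
    using measurable_space[OF fhat that] by simp
  have "N \<noteq> {}" using not_empty fN by blast
  then have D: "0 < D" using N by (simp add: D_def card_gt_0_iff)
  have meas: "(\<lambda>\<omega>. G (fhat \<omega>)) \<in> borel_measurable M"
    using fhat by (rule measurable_compose) simp
  have intG: "integrable M (\<lambda>\<omega>. G (fhat \<omega>))"
  proof (rule integrable_const_bound[OF _ meas])
    show "AE \<omega> in M. norm (G (fhat \<omega>)) \<le> (\<Sum>\<phi>\<in>N. \<bar>G \<phi>\<bar>)"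
      using N fN by (intro AE_I2) (auto intro!: member_le_sum)
  qed
  let ?R = "\<lambda>\<omega>. a + (ln D - 1 + (\<Sum>\<phi>\<in>N. exp (\<theta> * Z \<phi> \<omega>)) / D) / \<theta>"
  have "G (fhat \<omega>) \<le> ?R \<omega>" if \<omega>: "\<omega> \<in> space M" for \<omega>
  proof -
    let ?z = "Z (fhat \<omega>) \<omega>"
    \<comment> \<open>The tangent to exp is taken at \<open>ln D\<close> because the expectations
      add up to at most \<open>D\<close>: in the end -1 and +1 cancel and \<open>ln D\<close>
      remains.\<close>
    have "1 + (\<theta> * ?z - ln D) \<le> exp (\<theta> * ?z - ln D)" by (rule exp_ge_add_one_self)
    also have "\<dots> = exp (\<theta> * ?z) / D" using D by (simp add: exp_diff)
    also have "\<dots> \<le> (\<Sum>\<phi>\<in>N. exp (\<theta> * Z \<phi> \<omega>)) / D"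
      using D N fN[OF \<omega>] by (intro divide_right_mono member_le_sum) auto
    finally have "\<theta> * ?z \<le> ln D - 1 + (\<Sum>\<phi>\<in>N. exp (\<theta> * Z \<phi> \<omega>)) / D" by simp
    then have "?z \<le> (ln D - 1 + (\<Sum>\<phi>\<in>N. exp (\<theta> * Z \<phi> \<omega>)) / D) / \<theta>"
      using \<theta> by (simp add: pos_le_divide_eq mult.commute)
    then show ?thesis using G[OF \<omega>] by simp
  qed
  then have "expectation (\<lambda>\<omega>. G (fhat \<omega>)) \<le> expectation ?R"
    using intG int by (intro integral_mono) auto
  also have "\<dots> = a + (ln D - 1 + (\<Sum>\<phi>\<in>N. expectation (\<lambda>\<omega>. exp (\<theta> * Z \<phi> \<omega>))) / D) / \<theta>"
    using int by (simp add: prob_space)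
  also have "\<dots> \<le> a + (ln D - 1 + (\<Sum>\<phi>\<in>N. 1) / D) / \<theta>"
    using D \<theta> le1 by (intro add_left_mono divide_right_mono sum_mono) auto
  also have "\<dots> = a + ln D / \<theta>" using D by (simp add: D_def)
  finally show ?thesis by (simp add: D_def)
qed

text \<open>
  Up to the constant \<open>\<parallel>f\<parallel>\<^sup>2\<close>, the risk of \<open>\<phi>\<close> is \<open>\<parallel>\<phi> - f\<parallel>\<^sup>2\<close> minus the noise term \<open>X \<phi>\<close>.
\<close>

lemma (in prob_space) net_estimator_risk_le:
  fixes L :: "'b measure" and X :: "('b \<Rightarrow> real) \<Rightarrow> 'a \<Rightarrow> real"
  assumes N: "finite N" "N \<subseteq> L2 L" and f: "f \<in> L2 L"
    and \<phi>\<^sub>0: "\<phi>\<^sub>0 \<in> N" "l2_norm L (\<lambda>x. f x - \<phi>\<^sub>0 x) \<le> \<delta>"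
    and est: "net_estimator M \<gamma> N fhat"
    and \<xi>: "0 \<le> \<xi>" and \<theta>: "0 < \<theta>"
    and X: "\<And>\<phi> \<omega>. \<phi> \<in> N \<Longrightarrow> \<gamma> \<phi> \<omega> = (l2_norm L \<phi>)\<^sup>2 - 2 * (\<integral>x. \<phi> x * f x \<partial>L) - X \<phi> \<omega>"
    and mgf: "\<And>\<phi>. \<phi> \<in> N \<Longrightarrow> integrable M (\<lambda>\<omega>. exp (\<theta> * (X \<phi> \<omega> - X \<phi>\<^sub>0 \<omega>)))"
      "\<And>\<phi>. \<phi> \<in> N \<Longrightarrow> expectation (\<lambda>\<omega>. exp (\<theta> * (X \<phi> \<omega> - X \<phi>\<^sub>0 \<omega>)))
         \<le> exp (\<theta> * \<xi> * (l2_norm L (\<lambda>x. \<phi> x - \<phi>\<^sub>0 x))\<^sup>2)"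
  shows "(1 - 2 * \<xi>) * expectation (\<lambda>\<omega>. (l2_norm L (\<lambda>x. fhat \<omega> x - f x))\<^sup>2)
    \<le> (1 + 2 * \<xi>) * \<delta>\<^sup>2 + ln (real (card N)) / \<theta>"
proof -
  define d where "d \<phi> = (l2_norm L (\<lambda>x. \<phi> x - \<phi>\<^sub>0 x))\<^sup>2" for \<phi>
  define loss where "loss \<phi> = (l2_norm L (\<lambda>x. \<phi> x - f x))\<^sup>2" for \<phi>
  define Z where "Z \<phi> \<omega> = X \<phi> \<omega> - X \<phi>\<^sub>0 \<omega> - \<xi> * d \<phi>" for \<phi> \<omega>
  have fhat: "fhat \<in> measurable M (count_space N)"
    using est by (simp add: net_estimator_def)
  have sym: "l2_norm L (\<lambda>x. f x - \<phi>\<^sub>0 x) = l2_norm L (\<lambda>x. \<phi>\<^sub>0 x - f x)"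
    by (simp add: l2_norm_def power2_commute)
  have \<delta>: "loss \<phi>\<^sub>0 \<le> \<delta>\<^sup>2"
    unfolding loss_def using \<phi>\<^sub>0(2) l2_norm_nonneg sym by (metis power_mono)
  have loss: "loss \<phi> = \<gamma> \<phi> \<omega> + X \<phi> \<omega> + (l2_norm L f)\<^sup>2" if "\<phi> \<in> N" for \<phi> \<omega>
    using l2_norm_diff_sq[of \<phi> L f] X[OF that] N that f by (auto simp: loss_def)
  have G: "(1 - 2 * \<xi>) * loss (fhat \<omega>) \<le> (1 + 2 * \<xi>) * \<delta>\<^sup>2 + Z (fhat \<omega>) \<omega>"
    if \<omega>: "\<omega> \<in> space M" for \<omega>
  proof -
    let ?p = "fhat \<omega>"
    have min: "is_arg_min (\<lambda>\<phi>. \<gamma> \<phi> \<omega>) (\<lambda>\<phi>. \<phi> \<in> N) ?p"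
      using est \<omega> by (simp add: net_estimator_def)
    then have p: "?p \<in> N" and "\<gamma> ?p \<omega> \<le> \<gamma> \<phi>\<^sub>0 \<omega>"
      using \<phi>\<^sub>0(1) by (auto simp: is_arg_min_linorder)
    then have 1: "loss ?p \<le> loss \<phi>\<^sub>0 + (X ?p \<omega> - X \<phi>\<^sub>0 \<omega>)"
      using loss[OF p, of \<omega>] loss[OF \<phi>\<^sub>0(1), of \<omega>] by simp
    \<comment> \<open>The term \<open>\<xi> * d ?p\<close> subtracted in \<open>Z\<close> has to be
      added back. Bounded by losses, its part at \<open>?p\<close> moves to the left and leaves 1 -
      2\<xi>, its part at \<open>\<phi>\<^sub>0\<close> gives 1 + 2\<xi>.\<close>
    have "d ?p \<le> 2 * loss ?p + 2 * loss \<phi>\<^sub>0"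
      using l2_norm_diff_sq_le[of ?p L f \<phi>\<^sub>0] p \<phi>\<^sub>0(1) N f sym
      by (auto simp: d_def loss_def)
    then have "\<xi> * d ?p \<le> \<xi> * (2 * loss ?p + 2 * loss \<phi>\<^sub>0)" using \<xi> by (rule mult_left_mono)
    then have "(1 - 2 * \<xi>) * loss ?p \<le> (1 + 2 * \<xi>) * loss \<phi>\<^sub>0 + Z ?p \<omega>"
      using 1 by (simp add: Z_def algebra_simps)
    moreover have "(1 + 2 * \<xi>) * loss \<phi>\<^sub>0 \<le> (1 + 2 * \<xi>) * \<delta>\<^sup>2"
      using \<delta> \<xi> by (intro mult_left_mono) auto
    ultimately show ?thesis by linarith
  qed
  have *: "exp (\<theta> * Z \<phi> \<omega>) = exp (\<theta> * (X \<phi> \<omega> - X \<phi>\<^sub>0 \<omega>)) * exp (- \<theta> * \<xi> * d \<phi>)" for \<phi> \<omega>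
    by (simp add: Z_def exp_add[symmetric] algebra_simps)
  have "expectation (\<lambda>\<omega>. (1 - 2 * \<xi>) * loss (fhat \<omega>)) \<le> (1 + 2 * \<xi>) * \<delta>\<^sup>2 + ln (real (card N)) / \<theta>"
  proof (rule expectation_selection_le[OF N(1) fhat \<theta>, where G = "\<lambda>\<phi>. (1 - 2 * \<xi>) * loss \<phi>" and Z = Z])
    fix \<phi> assume \<phi>: "\<phi> \<in> N"
    show "integrable M (\<lambda>\<omega>. exp (\<theta> * Z \<phi> \<omega>))" unfolding * using mgf(1)[OF \<phi>] by simp
    have "expectation (\<lambda>\<omega>. exp (\<theta> * (X \<phi> \<omega> - X \<phi>\<^sub>0 \<omega>))) * exp (- \<theta> * \<xi> * d \<phi>)
      \<le> exp (\<theta> * \<xi> * d \<phi>) * exp (- \<theta> * \<xi> * d \<phi>)"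
      using mgf(2)[OF \<phi>] by (intro mult_right_mono) (auto simp: d_def)
    also have "\<dots> = 1" by (simp add: exp_add[symmetric])
    finally show "expectation (\<lambda>\<omega>. exp (\<theta> * Z \<phi> \<omega>)) \<le> 1" unfolding * by simp
  qed (rule G)
  then show ?thesis by (simp add: loss_def)
qed

subsection \<open>The two observation models\<close>

text \<open>This makes the empirical risk unbiased: moving \<open>Q\<close> over as
  \<open>Ainv\<close> onto \<open>A f\<close> recovers \<open>f\<close> almost everywhere.\<close>

lemma inner_adjoint_inverse:
  assumes inv: "inverse_L2 M N A Ainv" and A: "linear_L2 M N A" and adj: "adjoint_L2 N M Ainv Q"
    and f: "f \<in> L2 M" and g: "g \<in> L2 M"
  shows "(\<integral>y. Q g y * A f y \<partial>N) = (\<integral>x. g x * f x \<partial>M)"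
proof -
  have Af: "A f \<in> L2 N" using A f by (auto simp: linear_L2_def)
  have "linear_L2 N M Ainv" using inv by (simp add: inverse_L2_def)
  then have "Ainv (A f) \<in> L2 M" using Af by (auto simp: linear_L2_def)
  note [measurable] = L2_D(1)[OF this] L2_D(1)[OF f] L2_D(1)[OF g]
  have "(\<integral>y. Q g y * A f y \<partial>N) = (\<integral>x. Ainv (A f) x * g x \<partial>M)"
    using adj Af g by (auto simp: adjoint_L2_def mult.commute)
  also have "\<dots> = (\<integral>x. g x * f x \<partial>M)"
  proof (rule integral_cong_AE)
    have "AE x in M. Ainv (A f) x = f x" using inv f by (auto simp: inverse_L2_def)
    then show "AE x in M. Ainv (A f) x * g x = g x * f x"
      by eventually_elim (simp add: mult.commute)
  qed simp_all
  finally show ?thesis .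
qed

text \<open>The bound is stated for \<open>r\<close> strictly above the net operator norm, so that
  \<open>r\<close> is positive and \<theta> is well defined even if that norm is 0.\<close>

lemma (in prob_space) white_noise_risk_le:
  fixes L :: "'b measure" and \<nu> :: "'c measure" and \<xi> r :: real
  assumes A: "linear_L2 L \<nu> A" and inv: "inverse_L2 L \<nu> A Ainv" and adj: "adjoint_L2 \<nu> L Ainv Q"
    and N: "finite N" "N \<subseteq> L2 L" and f: "f \<in> L2 L"
    and \<phi>\<^sub>0: "\<phi>\<^sub>0 \<in> N" "l2_norm L (\<lambda>x. f x - \<phi>\<^sub>0 x) \<le> \<delta>"
    and n: "1 \<le> n" and \<xi>: "0 < \<xi>" and r: "net_op_norm L \<nu> Q N < r"
    and W: "brownian_process M \<nu> W"
    and est: "net_estimator M (white_noise_risk L Q (white_noise_obs \<nu> W n (A f))) N fhat"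
  shows "(1 - 2 * \<xi>) * expectation (\<lambda>\<omega>. (l2_norm L (\<lambda>x. fhat \<omega> x - f x))\<^sup>2)
    \<le> (1 + 2 * \<xi>) * \<delta>\<^sup>2 + ln (real (card N)) * (2 * r\<^sup>2 / (\<xi> * real n))"
proof -
  let ?X = "\<lambda>\<phi> \<omega>. 2 * W (Q \<phi>) \<omega> / sqrt (real n)"
  \<comment> \<open>The increment of \<open>?X\<close> has variance at most
    \<open>4 * r\<^sup>2 * ?d\<^sup>2 / n\<close>, hence log-moment at most
    \<open>2 * \<theta>\<^sup>2 * r\<^sup>2 * ?d\<^sup>2 / n\<close>. This \<theta> makes the latter
    equal to the permitted \<open>\<theta> * \<xi> * ?d\<^sup>2\<close>.\<close>
  define \<theta> where "\<theta> = \<xi> * real n / (2 * r\<^sup>2)"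
  have T: "linear_L2 \<nu> L Ainv" using inv by (simp add: inverse_L2_def)
  have r0: "0 < r" using net_op_norm_nonneg[OF N(1)] r by (rule le_less_trans)
  have \<theta>: "0 < \<theta>" using \<xi> n r0 by (simp add: \<theta>_def)
  have "(1 - 2 * \<xi>) * expectation (\<lambda>\<omega>. (l2_norm L (\<lambda>x. fhat \<omega> x - f x))\<^sup>2)
    \<le> (1 + 2 * \<xi>) * \<delta>\<^sup>2 + ln (real (card N)) / \<theta>"
  proof (rule net_estimator_risk_le[OF N f \<phi>\<^sub>0 est less_imp_le[OF \<xi>] \<theta>, where X = ?X])
    fix \<phi> assume \<phi>: "\<phi> \<in> N"
    then have L2: "\<phi> \<in> L2 L" "\<phi>\<^sub>0 \<in> L2 L" using N \<phi>\<^sub>0 by auto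
    show "white_noise_risk L Q (white_noise_obs \<nu> W n (A f)) \<phi> \<omega> =
      (l2_norm L \<phi>)\<^sup>2 - 2 * (\<integral>x. \<phi> x * f x \<partial>L) - ?X \<phi> \<omega>" for \<omega>
      by (simp add: white_noise_risk_def white_noise_obs_def
        inner_adjoint_inverse[OF inv A adj f L2(1)])
    let ?d = "l2_norm L (\<lambda>x. \<phi> x - \<phi>\<^sub>0 x)" and ?Qd = "l2_norm \<nu> (\<lambda>y. Q \<phi> y - Q \<phi>\<^sub>0 y)"
    let ?t = "2 * \<theta> / sqrt (real n)"
    have Q: "Q \<phi> \<in> L2 \<nu>" "Q \<phi>\<^sub>0 \<in> L2 \<nu>" using adj L2 by (auto simp: adjoint_L2_def)
    have *: "\<theta> * (?X \<phi> \<omega> - ?X \<phi>\<^sub>0 \<omega>) = ?t * (W (Q \<phi>) \<omega> - W (Q \<phi>\<^sub>0) \<omega>)" for \<omega>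
      by (simp add: diff_divide_distrib right_diff_distrib mult_ac)
    have mgf: "has_bochner_integral M (\<lambda>\<omega>. exp (\<theta> * (?X \<phi> \<omega> - ?X \<phi>\<^sub>0 \<omega>)))
      (exp (?t\<^sup>2 * ?Qd\<^sup>2 / 2))"
      unfolding * by (rule has_bochner_integral_exp_brownian[OF W Q])
    then show "integrable M (\<lambda>\<omega>. exp (\<theta> * (?X \<phi> \<omega> - ?X \<phi>\<^sub>0 \<omega>)))"
      by (simp add: has_bochner_integral_iff)
    have "?Qd \<le> net_op_norm L \<nu> Q N * ?d"
      by (rule net_op_norm_bound[OF T adj N \<phi> \<phi>\<^sub>0(1)])
    also have "\<dots> \<le> r * ?d" using r by (intro mult_right_mono) (auto simp: l2_norm_nonneg)
    finally have "?Qd\<^sup>2 \<le> (r * ?d)\<^sup>2" by (intro power_mono) (auto simp: l2_norm_nonneg)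
    then have "?t\<^sup>2 / 2 * ?Qd\<^sup>2 \<le> ?t\<^sup>2 / 2 * (r * ?d)\<^sup>2" by (intro mult_left_mono) auto
    also have "\<dots> = \<theta> * (2 * \<theta> * r\<^sup>2 / real n) * ?d\<^sup>2"
      using n by (simp add: power_mult_distrib power_divide power2_eq_square)
    also have "2 * \<theta> * r\<^sup>2 / real n = \<xi>" using r0 n by (simp add: \<theta>_def)
    finally show "expectation (\<lambda>\<omega>. exp (\<theta> * (?X \<phi> \<omega> - ?X \<phi>\<^sub>0 \<omega>))) \<le> exp (\<theta> * \<xi> * ?d\<^sup>2)"
      using mgf by (simp add: has_bochner_integral_iff)
  qed
  then show ?thesis by (simp add: \<theta>_def mult_ac)
qed

text \<open>The law of \<open>X\<close> has a density with respect to \<open>N\<close>, so it does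
  not charge null sets of \<open>N\<close>. This carries essential bounds over to the
  observations.\<close>

lemma (in prob_space) distributed_AE:
  assumes D: "distributed M N X p" and P: "AE y in N. P y"
  shows "AE \<omega> in M. P (X \<omega>)"
proof -
  have "AE y in distr M N X. P y"
    unfolding distributed_distr_eq_density[OF D]
    using P distributed_borel_measurable[OF D] by (subst AE_density) auto
  then show ?thesis by (rule AE_distrD[OF distributed_measurable[OF D]])
qed

text \<open>Second moments under the density \<open>A f\<close> are at most \<open>B\<close> times
  squared norms in L2 of \<nu>, and differences of two images are essentially bounded by
  \<open>2 * B'\<close>. These are the two inputs of Bernstein's exponential bound.\<close>

lemma (in prob_space) density_risk_le:
  fixes L :: "'b measure" and \<nu> :: "'c measure" and \<xi> \<rho> B B' :: real
  assumes A: "linear_L2 L \<nu> A" and inv: "inverse_L2 L \<nu> A Ainv" and adj: "adjoint_L2 \<nu> L Ainv Q"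
    and N: "finite N" "N \<subseteq> L2 L" and f: "f \<in> L2 L"
    and \<phi>\<^sub>0: "\<phi>\<^sub>0 \<in> N" "l2_norm L (\<lambda>x. f x - \<phi>\<^sub>0 x) \<le> \<delta>"
    and n: "1 \<le> n" and \<xi>: "0 < \<xi>" and \<rho>: "\<rho> = net_op_norm L \<nu> Q N" "0 < \<rho>"
    and B: "0 < B" "linf_norm \<nu> (A f) \<le> ereal B"
    and B': "0 < B'" "\<And>\<phi>. \<phi> \<in> N \<Longrightarrow> linf_norm \<nu> (Q \<phi>) \<le> ereal B'"
    and Y: "iid_sample M \<nu> n (A f) Y"
    and est: "net_estimator M (density_risk L Q n Y) N fhat"
  shows "(1 - 2 * \<xi>) * expectation (\<lambda>\<omega>. (l2_norm L (\<lambda>x. fhat \<omega> x - f x))\<^sup>2)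
    \<le> (1 + 2 * \<xi>) * \<delta>\<^sup>2 + ln (real (card N)) * (2 * (B * \<rho>\<^sup>2 + \<xi> * (2 * B' / 3)) / (\<xi> * real n))"
proof -
  let ?b = "2 * B'"
  \<comment> \<open>\<open>A f\<close> is nonnegative only almost everywhere, while the formula for
    expectations under a density needs it everywhere; \<open>ennreal\<close> does not distinguish
    \<open>p\<close> from \<open>A f\<close>.\<close>
  define p where "p y = max 0 (A f y)" for y
  \<comment> \<open>The solution of the linear equation \<open>s_eq\<close>, which equates the
    Bernstein exponent with the permitted one. The relation \<open>\<theta> * 2 / n = s\<close> then
    fixes \<theta>.\<close>
  define s where "s = \<xi> / (B * \<rho>\<^sup>2 + \<xi> * (?b / 3))"
  define \<theta> where "\<theta> = real n * s / 2"
  let ?X = "\<lambda>\<phi> \<omega>. 2 / real n * (\<Sum>i=1..n. Q \<phi> (Y i \<omega>)) - 2 * (\<integral>x. \<phi> x * f x \<partial>L)"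
  have T: "linear_L2 \<nu> L Ainv" using inv by (simp add: inverse_L2_def)
  have den: "0 < B * \<rho>\<^sup>2 + \<xi> * (?b / 3)" using B(1) B'(1) \<xi> by (intro add_nonneg_pos) auto
  have s: "0 < s" using den \<xi> by (simp add: s_def)
  have \<theta>: "0 < \<theta>" using n s by (simp add: \<theta>_def)
  have s_eq: "s * B * \<rho>\<^sup>2 = \<xi> * (1 - s * ?b / 3)"
    using den by (simp add: s_def field_simps)
  \<comment> \<open>Positivity of the left side of \<open>s_eq\<close> forces
    \<open>1 - s * ?b / 3 > 0\<close>, the range in which Bernstein's bound holds.\<close>
  have "0 < s * B * \<rho>\<^sup>2" using s B(1) \<rho>(2) by simp
  then have sb: "s * ?b < 3" using s_eq \<xi> by (simp add: zero_less_mult_iff)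
  have "(1 - 2 * \<xi>) * expectation (\<lambda>\<omega>. (l2_norm L (\<lambda>x. fhat \<omega> x - f x))\<^sup>2)
    \<le> (1 + 2 * \<xi>) * \<delta>\<^sup>2 + ln (real (card N)) / \<theta>"
  proof (rule net_estimator_risk_le[OF N f \<phi>\<^sub>0 est less_imp_le[OF \<xi>] \<theta>, where X = ?X])
    fix \<phi> assume \<phi>: "\<phi> \<in> N"
    then have L2: "\<phi> \<in> L2 L" "\<phi>\<^sub>0 \<in> L2 L" using N \<phi>\<^sub>0 by auto
    show "density_risk L Q n Y \<phi> \<omega> =
      (l2_norm L \<phi>)\<^sup>2 - 2 * (\<integral>x. \<phi> x * f x \<partial>L) - ?X \<phi> \<omega>" for \<omega>
      by (simp add: density_risk_def)
    let ?d = "l2_norm L (\<lambda>x. \<phi> x - \<phi>\<^sub>0 x)"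
    let ?u = "\<lambda>y. Q \<phi> y - Q \<phi>\<^sub>0 y"
    let ?U = "\<lambda>i \<omega>. ?u (Y i \<omega>)"
    let ?V = "B * (\<rho> * ?d)\<^sup>2"
    have Q: "Q \<phi> \<in> L2 \<nu>" "Q \<phi>\<^sub>0 \<in> L2 \<nu>" using adj L2 by (auto simp: adjoint_L2_def)
    have u: "?u \<in> L2 \<nu>" using Q by (rule L2_diff)
    note [measurable] = L2_D(1)[OF Q(1)] L2_D(1)[OF Q(2)]
    have Af: "A f \<in> L2 \<nu>" using A f by (auto simp: linear_L2_def)
    note [measurable] = L2_D(1)[OF Af]
    have p_AE: "AE y in \<nu>. p y = A f y"
      using Y by (auto simp: iid_sample_def prob_density_def p_def elim!: eventually_mono)
    have D: "distributed M \<nu> (Y i) (\<lambda>y. ennreal (p y))" if "i \<in> {1..n}" for i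
      using Y that by (simp add: iid_sample_def p_def ennreal_max_0)
    have "indep_vars (\<lambda>_. \<nu>) Y {1..n}" using Y by (simp add: iid_sample_def)
    then have ind: "indep_vars (\<lambda>_. borel) ?U {1..n}"
      by (rule indep_vars_compose2) simp
    have bnd: "AE \<omega> in M. \<bar>?U i \<omega>\<bar> \<le> ?b" if "i \<in> {1..n}" for i
    proof (rule distributed_AE[OF D[OF that]])
      show "AE y in \<nu>. \<bar>?u y\<bar> \<le> ?b"
        using linf_norm_AE_le[OF B'(2)[OF \<phi>]] linf_norm_AE_le[OF B'(2)[OF \<phi>\<^sub>0(1)]]
        by eventually_elim linarith
    qed
    have mean: "expectation (?U i) = (\<integral>x. \<phi> x * f x \<partial>L) - (\<integral>x. \<phi>\<^sub>0 x * f x \<partial>L)"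
      if "i \<in> {1..n}" for i
    proof -
      have "expectation (?U i) = (\<integral>y. p y * ?u y \<partial>\<nu>)"
        by (rule distributed_integral[OF D[OF that], symmetric]) (auto simp: p_def)
      also have "\<dots> = (\<integral>y. Q \<phi> y * A f y - Q \<phi>\<^sub>0 y * A f y \<partial>\<nu>)"
      proof (rule integral_cong_AE)
        show "AE y in \<nu>. p y * ?u y = Q \<phi> y * A f y - Q \<phi>\<^sub>0 y * A f y"
          using p_AE by eventually_elim (simp add: algebra_simps)
      qed (simp_all add: p_def)
      also have "\<dots> = (\<integral>x. \<phi> x * f x \<partial>L) - (\<integral>x. \<phi>\<^sub>0 x * f x \<partial>L)"
        using L2_mult_integrable[OF Q(1) Af] L2_mult_integrable[OF Q(2) Af]
        by (simp add: inner_adjoint_inverse[OF inv A adj f] L2)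
      finally show ?thesis .
    qed
    have "l2_norm \<nu> ?u \<le> \<rho> * ?d"
      unfolding \<rho>(1) by (rule net_op_norm_bound[OF T adj N \<phi> \<phi>\<^sub>0(1)])
    then have u_le: "(l2_norm \<nu> ?u)\<^sup>2 \<le> (\<rho> * ?d)\<^sup>2"
      by (intro power_mono) (auto simp: l2_norm_nonneg)
    have var: "expectation (\<lambda>\<omega>. (?U i \<omega>)\<^sup>2) \<le> ?V" if "i \<in> {1..n}" for i
    proof -
      have "expectation (\<lambda>\<omega>. (?U i \<omega>)\<^sup>2) = (\<integral>y. p y * (?u y)\<^sup>2 \<partial>\<nu>)"
        by (rule distributed_integral[OF D[OF that], symmetric]) (auto simp: p_def)
      also have "\<dots> \<le> (\<integral>y. B * (?u y)\<^sup>2 \<partial>\<nu>)"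
      proof (rule integral_mono_AE')
        show "AE y in \<nu>. p y * (?u y)\<^sup>2 \<le> B * (?u y)\<^sup>2"
          using linf_norm_AE_le[OF B(2)]
          by eventually_elim (use B(1) in \<open>auto simp: p_def intro!: mult_right_mono\<close>)
        show "AE y in \<nu>. 0 \<le> B * (?u y)\<^sup>2" using B(1) by simp
      qed (use L2_D(2)[OF u] in simp)
      also have "\<dots> = B * (l2_norm \<nu> ?u)\<^sup>2" by (simp add: l2_norm_sq)
      also have "\<dots> \<le> ?V" using B(1) u_le by (intro mult_left_mono) auto
      finally show ?thesis .
    qed
    \<comment> \<open>The integrals against \<open>f\<close> in \<open>?X\<close> are, after
      scaling, exactly the means of the summands.\<close>
    have *: "\<theta> * (?X \<phi> \<omega> - ?X \<phi>\<^sub>0 \<omega>) = s * (\<Sum>i=1..n. ?U i \<omega> - expectation (?U i))" for \<omega>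
    proof -
      have "(\<Sum>i=1..n. ?U i \<omega> - expectation (?U i)) =
        (\<Sum>i=1..n. ?U i \<omega> - ((\<integral>x. \<phi> x * f x \<partial>L) - (\<integral>x. \<phi>\<^sub>0 x * f x \<partial>L)))"
        by (rule sum.cong[OF refl]) (simp only: mean)
      also have "\<dots> = (\<Sum>i=1..n. Q \<phi> (Y i \<omega>)) - (\<Sum>i=1..n. Q \<phi>\<^sub>0 (Y i \<omega>))
        - real n * ((\<integral>x. \<phi> x * f x \<partial>L) - (\<integral>x. \<phi>\<^sub>0 x * f x \<partial>L))"
        by (simp add: sum_subtractf)
      finally have sum: "(\<Sum>i=1..n. ?U i \<omega> - expectation (?U i)) =
        (\<Sum>i=1..n. Q \<phi> (Y i \<omega>)) - (\<Sum>i=1..n. Q \<phi>\<^sub>0 (Y i \<omega>))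
        - real n * ((\<integral>x. \<phi> x * f x \<partial>L) - (\<integral>x. \<phi>\<^sub>0 x * f x \<partial>L))" .
      have "\<theta> * ((2 / real n * a - 2 * c) - (2 / real n * b - 2 * d)) = s * (a - b - real n * (c - d))"
        for a b c d
        using n by (simp add: \<theta>_def field_simps)
      then show ?thesis unfolding sum .
    qed
    note mgf = bernstein_exp_moment_sum[OF _ ind bnd var less_imp_le[OF s] sb]
    show "integrable M (\<lambda>\<omega>. exp (\<theta> * (?X \<phi> \<omega> - ?X \<phi>\<^sub>0 \<omega>)))"
      unfolding * by (rule mgf(1)) auto
    \<comment> \<open>Through \<open>s_eq\<close> one factor becomes
      \<open>\<xi> * (1 - s * ?b / 3)\<close>, which cancels the Bernstein denominator.\<close>
    have "s\<^sup>2 * ?V = s * ?d\<^sup>2 * (s * B * \<rho>\<^sup>2)"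
      by (simp add: power2_eq_square)
    also have "\<dots> = s * ?d\<^sup>2 * \<xi> * (1 - s * ?b / 3)"
      unfolding s_eq by (simp only: mult.assoc)
    finally have V: "s\<^sup>2 * ?V = s * ?d\<^sup>2 * \<xi> * (1 - s * ?b / 3)" .
    have "real n * (s * ?d\<^sup>2 * \<xi> * q / (2 * q)) = \<theta> * \<xi> * ?d\<^sup>2" if "q \<noteq> 0" for q
      using that by (simp add: \<theta>_def)
    moreover have "1 - s * ?b / 3 \<noteq> 0" using sb by linarith
    ultimately have "real n * (s\<^sup>2 * ?V / (2 * (1 - s * ?b / 3))) = \<theta> * \<xi> * ?d\<^sup>2"
      unfolding V by blast
    moreover have "expectation (\<lambda>\<omega>. exp (s * (\<Sum>i=1..n. ?U i \<omega> - expectation (?U i))))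
      \<le> exp (real (card {1..n}) * (s\<^sup>2 * ?V / (2 * (1 - s * ?b / 3))))"
      by (rule mgf(2)) auto
    ultimately show "expectation (\<lambda>\<omega>. exp (\<theta> * (?X \<phi> \<omega> - ?X \<phi>\<^sub>0 \<omega>))) \<le> exp (\<theta> * \<xi> * ?d\<^sup>2)"
      unfolding * by simp
  qed
  then show ?thesis by (simp add: \<theta>_def s_def mult_ac)
qed

section \<open>Matching the exponents with the assumed lower bounds for \<xi>\<close>

theorem theorem1:
  fixes \<nu> :: "'y measure" and M :: "'w measure"
    and A :: "(real ^ 'd \<Rightarrow> real) \<Rightarrow> 'y \<Rightarrow> real"
    and Ainv :: "('y \<Rightarrow> real) \<Rightarrow> real ^ 'd \<Rightarrow> real"
    and Q :: "(real ^ 'd \<Rightarrow> real) \<Rightarrow> 'y \<Rightarrow> real"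
    and F F\<delta> :: "(real ^ 'd \<Rightarrow> real) set"
    and B\<^sub>2 \<delta> C\<tau> \<xi> :: real and n :: nat
  assumes "prob_space M"
    and "linear_L2 lborel \<nu> A"
    and "inverse_L2 lborel \<nu> A Ainv"
    and "adjoint_L2 \<nu> lborel Ainv Q"
    and "F \<subseteq> L2 lborel"
    and "0 < B\<^sub>2" and "\<forall>g\<in>F. l2_norm lborel g \<le> B\<^sub>2"
    and "0 < \<delta>" and "finite F\<delta>" and "delta_net lborel \<delta> F F\<delta>"
    and "1 \<le> n" and "0 < C\<tau>"
  shows
    "(sqrt (2 / C\<tau>) \<le> \<xi> \<and> \<xi> < 1 / 2 \<longrightarrow>
        (\<forall>f\<in>F. \<forall>W fhat.
           brownian_process M \<nu> W \<and>
           net_estimator M (white_noise_risk lborel Q (white_noise_obs \<nu> W n (A f))) F\<delta> fhat \<longrightarrow>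
           (\<integral>\<omega>. (l2_norm lborel (\<lambda>x. fhat \<omega> x - f x))\<^sup>2 \<partial>M)
             \<le> inverse (1 - 2 * \<xi>) * (1 + 2 * \<xi>) * \<delta>\<^sup>2 +
               inverse (1 - 2 * \<xi>) * \<xi> * C\<tau> *
                 ((net_op_norm lborel \<nu> Q F\<delta>)\<^sup>2 * (ln (real (card F\<delta>)) + 1) / real n)))
     \<and>
     (\<forall>Binf Binf'.
        0 < Binf \<and> 0 < Binf' \<and>
        (\<forall>g\<in>F. prob_density lborel g) \<and>
        1 \<le> net_op_norm lborel \<nu> Q F\<delta> \<and>
        (\<forall>g\<in>F. linf_norm \<nu> (A g) \<le> ereal Binf) \<and>
        (\<forall>g\<in>F. linf_norm \<nu> (Q g) \<le> ereal Binf') \<and>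
        (\<forall>\<phi>\<in>F\<delta>. linf_norm \<nu> (Q \<phi>) \<le> ereal Binf') \<and>
        inverse C\<tau> * (4 * Binf' / 3 + sqrt (2 * (8 * (Binf')\<^sup>2 / 9 + C\<tau> * Binf))) \<le> \<xi> \<and> \<xi> < 1 / 2 \<longrightarrow>
        (\<forall>f\<in>F. \<forall>Y fhat.
           iid_sample M \<nu> n (A f) Y \<and>
           net_estimator M (density_risk lborel Q n Y) F\<delta> fhat \<longrightarrow>
           (\<integral>\<omega>. (l2_norm lborel (\<lambda>x. fhat \<omega> x - f x))\<^sup>2 \<partial>M)
             \<le> inverse (1 - 2 * \<xi>) * (1 + 2 * \<xi>) * \<delta>\<^sup>2 +
               inverse (1 - 2 * \<xi>) * \<xi> * C\<tau> *
                 ((net_op_norm lborel \<nu> Q F\<delta>)\<^sup>2 * (ln (real (card F\<delta>)) + 1) / real n)))"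
proof -
  interpret prob_space M by (rule assms(1))
  note A = assms(2) and inv = assms(3) and adj = assms(4) and fin = assms(9)
    and net = assms(10) and n = assms(11) and C\<tau> = assms(12)
  define \<rho> where "\<rho> = net_op_norm lborel \<nu> Q F\<delta>"
  let ?D = "real (card F\<delta>)"
  let ?C1 = "inverse (1 - 2 * \<xi>) * (1 + 2 * \<xi>)" and ?C2 = "inverse (1 - 2 * \<xi>) * \<xi> * C\<tau>"
  have N: "F\<delta> \<subseteq> L2 lborel" using net by (simp add: delta_net_def)
  have \<rho>: "0 \<le> \<rho>" unfolding \<rho>_def using fin by (rule net_op_norm_nonneg)
  have near: "\<exists>\<phi>\<^sub>0\<in>F\<delta>. l2_norm lborel (\<lambda>x. f x - \<phi>\<^sub>0 x) \<le> \<delta>" if "f \<in> F" for f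
    using net that by (simp add: delta_net_def)
  have fL2: "f \<in> L2 lborel" if "f \<in> F" for f using assms(5) that by auto
  have lnD: "0 \<le> ln ?D" if "f \<in> F" for f
  proof -
    have "0 < card F\<delta>" using near[OF that] fin by (auto simp: card_gt_0_iff)
    then show ?thesis by simp
  qed
  \<comment> \<open>Common to both models: \<open>K\<close> is \<open>2 * r\<^sup>2\<close> for
    white noise and \<open>2 * (Binf * \<rho>\<^sup>2 + \<xi> * (2 * Binf' / 3))\<close> for
    densities. The lower bound for \<xi> serves to verify the condition on \<open>K\<close>; the
    upper bound allows division by 1 - 2\<xi>.\<close>
  have concl: "E \<le> ?C1 * \<delta>\<^sup>2 + ?C2 * (r\<^sup>2 * (ln ?D + 1) / real n)"
    if \<xi>: "0 < \<xi>" "\<xi> < 1 / 2" and f: "f \<in> F" and K: "K \<le> \<xi>\<^sup>2 * C\<tau> * r\<^sup>2"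
      and E: "(1 - 2 * \<xi>) * E \<le> (1 + 2 * \<xi>) * \<delta>\<^sup>2 + ln ?D * (K / (\<xi> * real n))" for E K r f
  proof -
    have "K / (\<xi> * real n) \<le> \<xi>\<^sup>2 * C\<tau> * r\<^sup>2 / (\<xi> * real n)"
      using K \<xi> by (intro divide_right_mono) auto
    also have "\<dots> = \<xi> * C\<tau> * r\<^sup>2 / real n" using \<xi> by (simp add: power2_eq_square)
    finally have "ln ?D * (K / (\<xi> * real n)) \<le> ln ?D * (\<xi> * C\<tau> * r\<^sup>2 / real n)"
      using lnD[OF f] by (rule mult_left_mono)
    also have "\<dots> \<le> (ln ?D + 1) * (\<xi> * C\<tau> * r\<^sup>2 / real n)"
      using \<xi> C\<tau> by (intro mult_right_mono) auto
    finally have "(1 - 2 * \<xi>) * E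
      \<le> (1 + 2 * \<xi>) * \<delta>\<^sup>2 + \<xi> * C\<tau> * (r\<^sup>2 * (ln ?D + 1) / real n)"
      using E by (simp add: mult_ac)
    then have "inverse (1 - 2 * \<xi>) * ((1 - 2 * \<xi>) * E)
      \<le> inverse (1 - 2 * \<xi>) * ((1 + 2 * \<xi>) * \<delta>\<^sup>2 + \<xi> * C\<tau> * (r\<^sup>2 * (ln ?D + 1) / real n))"
      using \<xi> by (intro mult_left_mono) auto
    moreover have "inverse (1 - 2 * \<xi>) * ((1 - 2 * \<xi>) * E) = E" using \<xi> by simp
    ultimately show ?thesis by (simp only: distrib_left[where a = "inverse (1 - 2 * \<xi>)" and b = "(1 + 2 * \<xi>) * \<delta>\<^sup>2"] mult.assoc)
  qed
  show ?thesis
    unfolding \<rho>_def[symmetric]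
  proof (intro conjI impI allI ballI; (elim conjE)?)
    fix f W fhat
    assume \<xi>: "sqrt (2 / C\<tau>) \<le> \<xi>" "\<xi> < 1 / 2" and f: "f \<in> F" and W: "brownian_process M \<nu> W"
      and est: "net_estimator M (white_noise_risk lborel Q (white_noise_obs \<nu> W n (A f))) F\<delta> fhat"
    let ?E = "\<integral>\<omega>. (l2_norm lborel (\<lambda>x. fhat \<omega> x - f x))\<^sup>2 \<partial>M"
    obtain \<phi>\<^sub>0 where \<phi>\<^sub>0: "\<phi>\<^sub>0 \<in> F\<delta>" "l2_norm lborel (\<lambda>x. f x - \<phi>\<^sub>0 x) \<le> \<delta>"
      using near[OF f] by blast
    have "0 < sqrt (2 / C\<tau>)" using C\<tau> by simp
    then have \<xi>0: "0 < \<xi>" using \<xi>(1) by linarith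
    have "2 / C\<tau> \<le> \<xi>\<^sup>2" using \<xi>(1) by (rule sqrt_le_D)
    then have 2: "2 \<le> \<xi>\<^sup>2 * C\<tau>" using C\<tau> by (simp add: pos_divide_le_eq)
    \<comment> \<open>The exponent \<open>\<theta>\<close> is of order \<open>n / r\<^sup>2\<close>, and \<open>\<rho>\<close> may vanish.\<close>
    have bound: "?E \<le> ?C1 * \<delta>\<^sup>2 + ?C2 * (r\<^sup>2 * (ln ?D + 1) / real n)" if "\<rho> < r" for r
    proof (rule concl[OF \<xi>0 \<xi>(2) f])
      show "2 * r\<^sup>2 \<le> \<xi>\<^sup>2 * C\<tau> * r\<^sup>2" using 2 by (rule mult_right_mono) simp
      show "(1 - 2 * \<xi>) * ?E \<le> (1 + 2 * \<xi>) * \<delta>\<^sup>2 + ln ?D * (2 * r\<^sup>2 / (\<xi> * real n))"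
        using that unfolding \<rho>_def
        by (intro white_noise_risk_le[OF A inv adj fin N fL2[OF f] \<phi>\<^sub>0 n \<xi>0 _ W est])
    qed
    \<comment> \<open>The left side does not depend on \<open>r\<close> and the right side is
      continuous in it, so \<open>r\<close> may decrease to \<rho>.\<close>
    show "?E \<le> ?C1 * \<delta>\<^sup>2 + ?C2 * (\<rho>\<^sup>2 * (ln ?D + 1) / real n)"
    proof (rule tendsto_lowerbound)
      show "((\<lambda>r. ?C1 * \<delta>\<^sup>2 + ?C2 * (r\<^sup>2 * (ln ?D + 1) / real n)) \<longlongrightarrow>
        ?C1 * \<delta>\<^sup>2 + ?C2 * (\<rho>\<^sup>2 * (ln ?D + 1) / real n)) (at_right \<rho>)"
        using n by (intro tendsto_intros) auto
      show "\<forall>\<^sub>F r in at_right \<rho>. ?E \<le> ?C1 * \<delta>\<^sup>2 + ?C2 * (r\<^sup>2 * (ln ?D + 1) / real n)"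
        using bound by (auto simp: eventually_at_right_field intro: exI[of _ "\<rho> + 1"])
    qed simp
  next
    fix Binf Binf' f Y fhat
    assume B: "0 < Binf" "0 < Binf'" and \<rho>1: "1 \<le> \<rho>"
      and Af: "\<forall>g\<in>F. linf_norm \<nu> (A g) \<le> ereal Binf"
      and Q\<phi>: "\<forall>\<phi>\<in>F\<delta>. linf_norm \<nu> (Q \<phi>) \<le> ereal Binf'"
      and \<xi>: "inverse C\<tau> * (4 * Binf' / 3 + sqrt (2 * (8 * (Binf')\<^sup>2 / 9 + C\<tau> * Binf))) \<le> \<xi>"
        "\<xi> < 1 / 2"
      and f: "f \<in> F" and Y: "iid_sample M \<nu> n (A f) Y"
      and est: "net_estimator M (density_risk lborel Q n Y) F\<delta> fhat"
    obtain \<phi>\<^sub>0 where \<phi>\<^sub>0: "\<phi>\<^sub>0 \<in> F\<delta>" "l2_norm lborel (\<lambda>x. f x - \<phi>\<^sub>0 x) \<le> \<delta>"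
      using near[OF f] by blast
    let ?c = "4 * Binf' / 3" and ?q = "2 * (8 * (Binf')\<^sup>2 / 9 + C\<tau> * Binf)"
    have sq: "0 \<le> sqrt ?q" using B C\<tau> by simp
    have le: "?c + sqrt ?q \<le> C\<tau> * \<xi>"
    proof -
      have "?c + sqrt ?q = C\<tau> * (inverse C\<tau> * (?c + sqrt ?q))" using C\<tau> by simp
      also have "\<dots> \<le> C\<tau> * \<xi>" using \<xi>(1) C\<tau> by (intro mult_left_mono) auto
      finally show ?thesis .
    qed
    have "0 < ?c" using B by simp
    then have "0 < C\<tau> * \<xi>" using le sq by linarith
    then have \<xi>0: "0 < \<xi>" using C\<tau> by (simp add: zero_less_mult_iff)
    \<comment> \<open>The lower bound for \<xi> is the larger root of the quadratic
      \<open>C\<tau> * x\<^sup>2 - 2 * ?c * x - 2 * Binf\<close>, since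
      \<open>?q = ?c\<^sup>2 + 2 * C\<tau> * Binf\<close>. Squaring shows that the quadratic is
      nonnegative at \<xi>.\<close>
    have "?q \<le> (C\<tau> * \<xi> - ?c)\<^sup>2" using le by (intro sqrt_le_D) linarith
    also have "\<dots> = C\<tau> * (C\<tau> * \<xi>\<^sup>2 - 2 * \<xi> * ?c) + 16 * Binf'\<^sup>2 / 9"
      by (simp add: power2_eq_square field_simps)
    finally have "C\<tau> * (2 * Binf) \<le> C\<tau> * (C\<tau> * \<xi>\<^sup>2 - 2 * \<xi> * ?c)"
      by (simp add: algebra_simps)
    then have "2 * Binf \<le> C\<tau> * \<xi>\<^sup>2 - 2 * \<xi> * ?c" using C\<tau> by simp
    \<comment> \<open>The quadratic yields the linear term \<open>8 * \<xi> * Binf' / 3\<close>, of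
      which \<open>key\<close> keeps half.\<close>
    moreover have "0 \<le> \<xi> * Binf'" using \<xi>0 B by simp
    ultimately have key: "2 * (Binf + \<xi> * (2 * Binf' / 3)) \<le> \<xi>\<^sup>2 * C\<tau>"
      by (simp add: algebra_simps)
    \<comment> \<open>Here \<rho> \<ge> 1 lets the sup-norm term of Bernstein's bound, which carries
      no \<rho>, be absorbed into a multiple of \<open>\<rho>\<^sup>2\<close>.\<close>
    have "\<xi> * (2 * Binf' / 3) * 1 \<le> \<xi> * (2 * Binf' / 3) * \<rho>\<^sup>2"
      using \<xi>0 B \<rho>1 by (intro mult_left_mono) auto
    then have "2 * (Binf * \<rho>\<^sup>2 + \<xi> * (2 * Binf' / 3)) \<le> 2 * (Binf + \<xi> * (2 * Binf' / 3)) * \<rho>\<^sup>2"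
      by (simp add: algebra_simps)
    also have "\<dots> \<le> \<xi>\<^sup>2 * C\<tau> * \<rho>\<^sup>2" using key by (rule mult_right_mono) simp
    finally have K: "2 * (Binf * \<rho>\<^sup>2 + \<xi> * (2 * Binf' / 3)) \<le> \<xi>\<^sup>2 * C\<tau> * \<rho>\<^sup>2" .
    show "(\<integral>\<omega>. (l2_norm lborel (\<lambda>x. fhat \<omega> x - f x))\<^sup>2 \<partial>M)
      \<le> ?C1 * \<delta>\<^sup>2 + ?C2 * (\<rho>\<^sup>2 * (ln ?D + 1) / real n)"
      using Af Q\<phi> f \<rho>1
      by (intro concl[OF \<xi>0 \<xi>(2) f K] density_risk_le[OF A inv adj fin N fL2[OF f] \<phi>\<^sub>0 n \<xi>0 \<rho>_def
        _ B(1) _ B(2) _ Y est]) simp_all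
  qed
qed

end
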